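(* Let $m,n\ge 0$ be integers with $m+n\geq 2$ and let $I$ be a non-abelian graded ideal of the Heisenberg Lie superalgebra $H(m,n)$. Then the pair $(H(m,n),I)$ is not capable.
   Context: All Lie superalgebras are over a field $\mathbb{F}$ of characteristic different from $2,3$. $H(m,n)$ is the Heisenberg Lie superalgebra with even center: its even part has basis $x_1,\dots,x_{2m},z$, its odd part has basis $y_1,\dots,y_n$, and its only nonzero brackets of basis elements (up to graded skew-symmetry) are $[x_i,x_{m+i}]=z$ $(1\le i\le m)$ and $[y_j,y_j]=z$ $(1\le j\le n)$. A pair of Lie superalgebras $(L,I)$ is a Lie superalgebra $L$ with a graded ideal $I$ of $L$. Homomorphisms of Lie superalgebras are linear, even and bracket-preserving. An action of $L$ on a Lie superalgebra $N$ is an even bilinear map $L\times N\to N$, $(l,n)\mapsto {}^l n$, with ${}^{[l,l']}n={}^l({}^{l'}n)-(-1)^{|l||l'|}\,{}^{l'}({}^l n)$ and ${}^l[n,n']=[{}^l n,n']+(-1)^{|l||n|}[n,{}^l n']$ for homogeneous elements. A relative central extension of $(L,I)$ is a Lie superalgebra homomorphism $\beta:N\to L$ together with an action of $L$ on $N$ such that: (1) $\beta(N)=I$; (2) $\beta({}^l n)=[l,\beta(n)]$; (3) ${}^{\beta(n_1)}n=[n_1,n]$; (4) $\ker\beta\subseteq Z[L,N]$, where $Z[L,N]=\{n\in N\mid {}^l n=0\ \forall l\in L\}$. The pair $(L,I)$ is capable if it has a relative central extension $\beta:N\to L$ with $\ker\beta=Z[L,N]$. *)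

theory Defs
  imports
    Complex_Main
    "HOL-Library.Z2"
    "HOL-Library.Function_Algebras"
begin

text \<open>
  A superspace is given by its two homogeneous parts inside an ambient vector space, which is a
  whole type. Parities have type \<^typ>\<open>bit\<close>, so that addition of parities is addition mod 2. The
  bracket is a total function, but only its values on the carrier matter.
\<close>

record ('f, 'v) superalgebra =
  sscale :: "'f \<Rightarrow> 'v \<Rightarrow> 'v"
  part :: "bit \<Rightarrow> 'v set"
  bracket :: "'v \<Rightarrow> 'v \<Rightarrow> 'v"

definition scarrier :: "('f, 'v::ab_group_add) superalgebra \<Rightarrow> 'v set" where
  "scarrier L = {a + b |a b. a \<in> part L 0 \<and> b \<in> part L 1}"

text \<open>The sign $(-1)^{ij}$.\<close>

definition ssign :: "bit \<Rightarrow> bit \<Rightarrow> 'f::ring_1" where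
  "ssign i j = (if i = 1 \<and> j = 1 then - 1 else 1)"

definition linear_on ::
  "('f \<Rightarrow> 'v \<Rightarrow> 'v) \<Rightarrow> ('f \<Rightarrow> 'w \<Rightarrow> 'w) \<Rightarrow> 'v set \<Rightarrow> ('v::ab_group_add \<Rightarrow> 'w::ab_group_add) \<Rightarrow> bool" where
  "linear_on s t V f \<longleftrightarrow>
     (\<forall>x\<in>V. \<forall>y\<in>V. f (x + y) = f x + f y) \<and> (\<forall>c. \<forall>x\<in>V. f (s c x) = t c (f x))"

definition bilinear_on ::
  "('f \<Rightarrow> 'u \<Rightarrow> 'u) \<Rightarrow> ('f \<Rightarrow> 'v \<Rightarrow> 'v) \<Rightarrow> ('f \<Rightarrow> 'w \<Rightarrow> 'w) \<Rightarrow> 'u set \<Rightarrow> 'v set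
    \<Rightarrow> ('u::ab_group_add \<Rightarrow> 'v::ab_group_add \<Rightarrow> 'w::ab_group_add) \<Rightarrow> bool" where
  "bilinear_on r s t U V f \<longleftrightarrow>
     (\<forall>u\<in>U. linear_on s t V (f u)) \<and> (\<forall>v\<in>V. linear_on r t U (\<lambda>u. f u v))"

text \<open>
  Graded skew-symmetry and the graded Jacobi identity suffice as axioms only if the
  characteristic is not 2 or 3; that is assumed wherever the notion is used.
\<close>

locale lie_superalgebra = vector_space "sscale L"
  for L :: "('f::field, 'v::ab_group_add) superalgebra" +
  assumes subspace_part: "subspace (part L i)"
    and parts_independent: "part L 0 \<inter> part L 1 = {0}"
    and bracket_bilinear:
      "bilinear_on (sscale L) (sscale L) (sscale L) (scarrier L) (scarrier L) (bracket L)"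
    and bracket_even:
      "\<lbrakk>x \<in> part L i; y \<in> part L j\<rbrakk> \<Longrightarrow> bracket L x y \<in> part L (i + j)"
    and bracket_skew:
      "\<lbrakk>x \<in> part L i; y \<in> part L j\<rbrakk> \<Longrightarrow>
         bracket L x y = - sscale L (ssign i j) (bracket L y x)"
    and jacobi:
      "\<lbrakk>x \<in> part L i; y \<in> part L j; w \<in> part L k\<rbrakk> \<Longrightarrow>
         bracket L x (bracket L y w) =
           bracket L (bracket L x y) w + sscale L (ssign i j) (bracket L y (bracket L x w))"

definition graded_ideal :: "('f::field, 'v::ab_group_add) superalgebra \<Rightarrow> 'v set \<Rightarrow> bool" where
  "graded_ideal L I \<longleftrightarrow>
     I \<subseteq> scarrier L \<and> module.subspace (sscale L) I \<and>
     (\<forall>x\<in>I. \<exists>a\<in>I \<inter> part L 0. \<exists>b\<in>I \<inter> part L 1. x = a + b) \<and>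
     (\<forall>x\<in>scarrier L. \<forall>y\<in>I. bracket L x y \<in> I \<and> bracket L y x \<in> I)"

definition abelian_on :: "('f, 'v::zero) superalgebra \<Rightarrow> 'v set \<Rightarrow> bool" where
  "abelian_on L S \<longleftrightarrow> (\<forall>x\<in>S. \<forall>y\<in>S. bracket L x y = 0)"

definition lie_super_hom ::
  "('f, 'w::ab_group_add) superalgebra \<Rightarrow> ('f, 'v::ab_group_add) superalgebra \<Rightarrow> ('w \<Rightarrow> 'v) \<Rightarrow> bool"
  where
  "lie_super_hom N L \<beta> \<longleftrightarrow>
     linear_on (sscale N) (sscale L) (scarrier N) \<beta> \<and>
     (\<forall>i. \<beta> ` part N i \<subseteq> part L i) \<and>
     (\<forall>x\<in>scarrier N. \<forall>y\<in>scarrier N. \<beta> (bracket N x y) = bracket L (\<beta> x) (\<beta> y))"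

definition lie_super_action ::
  "('f::ring_1, 'v::ab_group_add) superalgebra \<Rightarrow> ('f, 'w::ab_group_add) superalgebra
    \<Rightarrow> ('v \<Rightarrow> 'w \<Rightarrow> 'w) \<Rightarrow> bool"
  where
  "lie_super_action L N act \<longleftrightarrow>
     bilinear_on (sscale L) (sscale N) (sscale N) (scarrier L) (scarrier N) act \<and>
     (\<forall>i j. \<forall>l\<in>part L i. \<forall>x\<in>part N j. act l x \<in> part N (i + j)) \<and>
     (\<forall>i j k. \<forall>l\<in>part L i. \<forall>l'\<in>part L j. \<forall>x\<in>part N k.
        act (bracket L l l') x =
          act l (act l' x) - sscale N (ssign i j) (act l' (act l x))) \<and>
     (\<forall>i j k. \<forall>l\<in>part L i. \<forall>x\<in>part N j. \<forall>x'\<in>part N k.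
        act l (bracket N x x') =
          bracket N (act l x) x' + sscale N (ssign i j) (bracket N x (act l x')))"

definition super_ker ::
  "('f, 'w::ab_group_add) superalgebra \<Rightarrow> ('w \<Rightarrow> 'v::zero) \<Rightarrow> 'w set" where
  "super_ker N \<beta> = {x \<in> scarrier N. \<beta> x = 0}"

definition act_center ::
  "('f, 'v::ab_group_add) superalgebra \<Rightarrow> ('f, 'w::ab_group_add) superalgebra
    \<Rightarrow> ('v \<Rightarrow> 'w \<Rightarrow> 'w) \<Rightarrow> 'w set" where
  "act_center L N act = {x \<in> scarrier N. \<forall>l\<in>scarrier L. act l x = 0}"

definition relative_central_extension ::
  "('f::field, 'v::ab_group_add) superalgebra \<Rightarrow> 'v set \<Rightarrow> ('f, 'w::ab_group_add) superalgebra
    \<Rightarrow> ('w \<Rightarrow> 'v) \<Rightarrow> ('v \<Rightarrow> 'w \<Rightarrow> 'w) \<Rightarrow> bool" where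
  "relative_central_extension L I N \<beta> act \<longleftrightarrow>
     lie_superalgebra N \<and> lie_super_hom N L \<beta> \<and> lie_super_action L N act \<and>
     \<beta> ` scarrier N = I \<and>
     (\<forall>l\<in>scarrier L. \<forall>x\<in>scarrier N. \<beta> (act l x) = bracket L l (\<beta> x)) \<and>
     (\<forall>x\<^sub>1\<in>scarrier N. \<forall>x\<in>scarrier N. act (\<beta> x\<^sub>1) x = bracket N x\<^sub>1 x) \<and>
     super_ker N \<beta> \<subseteq> act_center L N act"

text \<open>
  HOL cannot quantify over types inside a formula, so the ambient type of the extension is a
  parameter. A pair is capable iff this holds for some type \<open>'w\<close>; hence it is not capable iff the
  negation holds with \<open>'w\<close> a free (universally quantified) type variable. Every vector space is
  isomorphic to one whose carrier is a whole type, so no extension is lost.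
\<close>

definition capable_pair ::
  "'w::ab_group_add itself \<Rightarrow> ('f::field, 'v::ab_group_add) superalgebra \<Rightarrow> 'v set \<Rightarrow> bool" where
  "capable_pair _ L I \<longleftrightarrow>
     (\<exists>(N :: ('f, 'w) superalgebra) \<beta> act.
        relative_central_extension L I N \<beta> act \<and> super_ker N \<beta> = act_center L N act)"

text \<open>
  $H(m,n)$ consists of the coordinate functions supported on the basis \<open>X 1, \<dots>, X (2 * m), Z\<close>
  (even) and \<open>Y 1, \<dots>, Y n\<close> (odd); the bracket is the bilinear extension of the brackets of basis
  elements.
\<close>

datatype heis_basis = X nat | Y nat | Z

definition heis_index :: "nat \<Rightarrow> nat \<Rightarrow> bit \<Rightarrow> heis_basis set" where
  "heis_index m n i = (if i = 0 then insert Z (X ` {1..2 * m}) else Y ` {1..n})"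

definition heisenberg :: "nat \<Rightarrow> nat \<Rightarrow> ('f::field, heis_basis \<Rightarrow> 'f) superalgebra" where
  "heisenberg m n =
     \<lparr> sscale = (\<lambda>c v b. c * v b),
       part = (\<lambda>i. {v. \<forall>b. b \<notin> heis_index m n i \<longrightarrow> v b = 0}),
       bracket = (\<lambda>u v b.
         if b = Z
         then (\<Sum>i=1..m. u (X i) * v (X (m + i)) - u (X (m + i)) * v (X i))
              + (\<Sum>j=1..n. u (Y j) * v (Y j))
         else 0) \<rparr>"

text \<open>The following facts confirm that this is the intended Lie superalgebra.\<close>

definition heis_unit :: "heis_basis \<Rightarrow> heis_basis \<Rightarrow> 'f::field" where
  "heis_unit b = (\<lambda>b'. if b' = b then 1 else 0)"

lemma heisenberg_simps:
  "sscale (heisenberg m n) c v = (\<lambda>b. c * v b)"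
  "v \<in> part (heisenberg m n) i \<longleftrightarrow> (\<forall>b. b \<notin> heis_index m n i \<longrightarrow> v b = 0)"
  "bracket (heisenberg m n) u v = (\<lambda>b.
         if b = Z
         then (\<Sum>i=1..m. u (X i) * v (X (m + i)) - u (X (m + i)) * v (X i))
              + (\<Sum>j=1..n. u (Y j) * v (Y j))
         else 0)"
  by (simp_all add: heisenberg_def)

lemma heisenberg_basis_brackets:
  fixes m n :: nat
  defines "br \<equiv> bracket (heisenberg m n :: ('f::field, heis_basis \<Rightarrow> 'f) superalgebra)"
  shows "\<lbrakk>i \<in> {1..2 * m}; k \<in> {1..2 * m}\<rbrakk> \<Longrightarrow>
      br (heis_unit (X i)) (heis_unit (X k)) =
        (if k = m + i then heis_unit Z else if i = m + k then - heis_unit Z else 0)"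
    and "\<lbrakk>j \<in> {1..n}; k \<in> {1..n}\<rbrakk> \<Longrightarrow>
      br (heis_unit (Y j)) (heis_unit (Y k)) = (if j = k then heis_unit Z else 0)"
    and "br (heis_unit (X i)) (heis_unit (Y j)) = 0"
    and "br (heis_unit (Y j)) (heis_unit (X i)) = 0"
    and "br (heis_unit Z) v = 0"
    and "br v (heis_unit Z) = 0"
proof -
  assume ik: "i \<in> {1..2 * m}" "k \<in> {1..2 * m}"
  have d: "(\<Sum>l=1..m. (if a = l then (1::'f) else 0) * (if b = m + l then 1 else 0)) =
        (if a \<in> {1..m} \<and> b = m + a then 1 else 0)" for a b
  proof -
    have "(\<Sum>l=1..m. (if a = l then (1::'f) else 0) * (if b = m + l then 1 else 0)) =
       (\<Sum>l=1..m. (if a = l then (if b = m + a then 1 else 0) else 0))"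
      by (rule sum.cong) auto
    then show ?thesis by (simp add: sum.delta)
  qed
  have e: "(\<Sum>l=1..m. heis_unit (X i) (X l) * heis_unit (X k) (X (m + l))
            - heis_unit (X i) (X (m + l)) * heis_unit (X k) (X l)) =
       (if k = m + i then (1::'f) else 0) - (if i = m + k then 1 else 0)"
    using d[of i k] d[of k i] ik
    by (simp add: heis_unit_def sum_subtractf eq_commute[of _ i] eq_commute[of _ k] mult.commute)
  show "br (heis_unit (X i)) (heis_unit (X k)) =
        (if k = m + i then heis_unit Z else if i = m + k then - heis_unit Z else 0)"
    unfolding br_def heisenberg_simps e using ik
    by (auto simp: fun_eq_iff heis_unit_def)
next
  assume jk: "j \<in> {1..n}" "k \<in> {1..n}"
  have "(\<Sum>l=1..n. heis_unit (Y j) (Y l) * heis_unit (Y k) (Y l)) =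
       (\<Sum>l=1..n. if j = l then (if j = k then (1::'f) else 0) else 0)"
    by (rule sum.cong) (auto simp: heis_unit_def)
  also have "\<dots> = (if j = k then 1 else 0)"
    using jk by (simp add: sum.delta)
  finally have e: "(\<Sum>l=1..n. heis_unit (Y j) (Y l) * heis_unit (Y k) (Y l)) =
       (if j = k then (1::'f) else 0)" .
  show "br (heis_unit (Y j)) (heis_unit (Y k)) = (if j = k then heis_unit Z else 0)"
    unfolding br_def heisenberg_simps e by (auto simp: fun_eq_iff heis_unit_def)
qed (simp_all add: br_def heisenberg_simps heis_unit_def fun_eq_iff)

lemma Z_notin_index_1: "Z \<notin> heis_index m n 1"
  and X_notin_index_1: "X i \<notin> heis_index m n 1"
  and Y_notin_index_0: "Y i \<notin> heis_index m n 0"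
  by (auto simp: heis_index_def)

lemma lie_superalgebra_heisenberg:
  "lie_superalgebra (heisenberg m n :: ('f::field, heis_basis \<Rightarrow> 'f) superalgebra)"
proof -
  let ?H = "heisenberg m n :: ('f, heis_basis \<Rightarrow> 'f) superalgebra"
  interpret vector_space "sscale ?H"
    by unfold_locales (simp_all add: heisenberg_simps fun_eq_iff algebra_simps)
  have bil: "bilinear_on (sscale ?H) (sscale ?H) (sscale ?H) (scarrier ?H) (scarrier ?H) (bracket ?H)"
    by (auto simp: bilinear_on_def linear_on_def heisenberg_simps fun_eq_iff algebra_simps
        sum.distrib sum_subtractf sum_distrib_left)
  have central: "bracket ?H u (bracket ?H v w) = 0" "bracket ?H (bracket ?H u v) w = 0" for u v w
    by (simp_all add: heisenberg_simps fun_eq_iff)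
  show ?thesis
  proof unfold_locales
    fix i show "subspace (part ?H i)"
      by (auto simp: subspace_def heisenberg_simps)
  next
    show "part ?H 0 \<inter> part ?H 1 = {0}"
      by (auto simp: heisenberg_simps fun_eq_iff)
        (metis X_notin_index_1 Y_notin_index_0 Z_notin_index_1 heis_basis.exhaust)
  next
    fix x y :: "heis_basis \<Rightarrow> 'f" and i j
    assume xy: "x \<in> part ?H i" "y \<in> part ?H j"
    have 1: "x (Y k) = 0" if "i = 0" for k
      using xy that Y_notin_index_0 by (auto simp: heisenberg_simps)
    have 2: "y (Y k) = 0" if "j = 0" for k
      using xy that Y_notin_index_0 by (auto simp: heisenberg_simps)
    have 3: "x (X k) = 0" if "i = 1" for k
      using xy that X_notin_index_1 by (auto simp: heisenberg_simps)
    have 4: "y (X k) = 0" if "j = 1" for k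
      using xy that X_notin_index_1 by (auto simp: heisenberg_simps)
    show "bracket ?H x y \<in> part ?H (i + j)"
      using 1 2 3 4
      by (cases i; cases j) (auto simp: heisenberg_simps heis_index_def)
    show "bracket ?H x y = - sscale ?H (ssign i j) (bracket ?H y x)"
      using 1 2 3 4
      by (cases i; cases j)
        (auto simp: heisenberg_simps ssign_def fun_eq_iff sum_negf[symmetric] algebra_simps
          intro!: sum.cong)
  qed (use bil central in \<open>auto simp: heisenberg_simps(1) fun_eq_iff\<close>)
qed

end

theory Submission
  imports Defs
begin

text \<open>
  Let \<open>\<beta> : N \<rightarrow> H(m,n)\<close> be a relative central extension of the pair and suppose that
  \<open>t \<in> N\<close> is an even element over the central basis vector \<open>z\<close>. Such a \<open>t\<close> exists, because a
  non-abelian graded ideal contains homogeneous \<open>u\<close>, \<open>v\<close> with \<open>[u,v]\<close> a nonzero multiple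
  of \<open>z\<close>, and lifts of \<open>u\<close>, \<open>v\<close> can be multiplied in \<open>N\<close>. The claim is that every \<open>l\<close> in
  \<open>H(m,n)\<close> annihilates \<open>t\<close>. Then \<open>t \<in> Z[L,N]\<close> while \<open>\<beta> t = z \<noteq> 0\<close>, so \<open>ker \<beta> \<noteq> Z[L,N]\<close>.

  Write \<open>f l\<close> for the action of \<open>l\<close> on \<open>t\<close>, and \<open>\<omega>\<close> for the bilinear form with
  \<open>[l,l'] = \<omega> l l' z\<close>. Since \<open>ker \<beta>\<close> is annihilated by \<open>L\<close>, the action of \<open>l\<close> on \<open>x \<in> N\<close> depends
  only on \<open>\<beta> x\<close>; in particular it is \<open>c f l\<close> when \<open>\<beta> x = c z\<close>. Acting with \<open>l\<close> on the product of
  lifts of \<open>u, v \<in> I\<close> turns the derivation rule into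
  \<open>\<omega> u v f l = - \<omega> l u f v \<plusminus> \<omega> l v f u\<close> (lemma \<open>form_times_value\<close>), and acting with
  \<open>[l,l']\<close> on a lift of \<open>u \<in> I\<close> gives \<open>- \<omega> l l' f u = \<omega> l' u f l \<mp> \<omega> l u f l'\<close>
  (lemma \<open>value_of_ideal_element\<close>). By the first identity it is enough that \<open>f u = f v = 0\<close> for some
  homogeneous \<open>u, v \<in> I\<close> with \<open>\<omega> u v \<noteq> 0\<close>; such \<open>u\<close>, \<open>v\<close> have equal parity.

  For odd \<open>u\<close>, \<open>v\<close> the first identity alone suffices: if \<open>u\<close> is not isotropic it gives
  \<open>3 f u = 0\<close>, and if both are isotropic it gives \<open>2 f u = 2 f v = 0\<close>. This is where the
  characteristic enters. For even \<open>u\<close> choose a basis vector \<open>a\<close> with \<open>\<omega> a u \<noteq> 0\<close>. Since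
  \<open>m + n \<ge> 2\<close>, there are basis vectors \<open>b\<close>, \<open>c\<close> orthogonal to \<open>a\<close> with \<open>\<omega> b c \<noteq> 0\<close>. The second
  identity for \<open>(a,b)\<close> and \<open>(a,c)\<close> makes \<open>f b\<close> and \<open>f c\<close> proportional to \<open>f a\<close> with factors
  \<open>\<omega> b u\<close> and \<open>\<omega> c u\<close>, and for \<open>(b,c)\<close> it then yields \<open>f u = 0\<close>.
\<close>

section \<open>Homogeneous lifts\<close>

lemma (in lie_superalgebra) part_subset_scarrier: "x \<in> part L i \<Longrightarrow> x \<in> scarrier L"
proof -
  assume x: "x \<in> part L i"
  have 0: "0 \<in> part L j" for j by (rule subspace_0[OF subspace_part])
  show ?thesis
  proof (cases "i = 0")
    case True
    then have "x = x + 0 \<and> x \<in> part L 0 \<and> 0 \<in> part L 1" using x 0 by simp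
    then show ?thesis unfolding scarrier_def by blast
  next
    case False
    then have "i = 1" by simp
    then have "x = 0 + x \<and> 0 \<in> part L 0 \<and> x \<in> part L 1" using x 0 by simp
    then show ?thesis unfolding scarrier_def by blast
  qed
qed

lemma (in lie_superalgebra) homogeneous_component:
  assumes "a \<in> part L 0" "b \<in> part L 1" "a + b \<in> part L i"
  shows "a + b = (if i = 0 then a else b)"
proof (cases "i = 0")
  case True
  have "(a + b) - a \<in> part L i"
    by (rule subspace_diff[OF subspace_part assms(3)]) (simp add: assms(1) True)
  then have "b \<in> part L 0 \<inter> part L 1" using assms(2) True by simp
  then have "b = 0" using parts_independent by simp
  then show ?thesis using True by simp
next
  case False
  then have i: "i = 1" by simp
  have "(a + b) - b \<in> part L i"
    by (rule subspace_diff[OF subspace_part assms(3)]) (simp add: assms(2) i)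
  then have "a \<in> part L 0 \<inter> part L 1" using assms(1) i by simp
  then have "a = 0" using parts_independent by simp
  then show ?thesis using False by simp
qed

text \<open>
  An arbitrary preimage of a homogeneous element has a component of the wrong parity, but \<open>\<beta>\<close> is even
  and therefore maps that component to 0.
\<close>

lemma homogeneous_lift:
  assumes L: "lie_superalgebra L" and \<beta>: "lie_super_hom N L \<beta>"
    and u: "u \<in> \<beta> ` scarrier N" "u \<in> part L i" and N: "lie_superalgebra N"
  obtains x where "x \<in> part N i" "\<beta> x = u"
proof -
  obtain p q where pq: "p \<in> part N 0" "q \<in> part N 1" "u = \<beta> (p + q)"
    using u(1) unfolding scarrier_def by blast
  have "p \<in> scarrier N" "q \<in> scarrier N"
    using lie_superalgebra.part_subset_scarrier[OF N] pq(1,2) by blast+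
  then have sum: "u = \<beta> p + \<beta> q"
    using \<beta> pq(3) unfolding lie_super_hom_def linear_on_def by simp
  have parts: "\<beta> p \<in> part L 0" "\<beta> q \<in> part L 1"
    using \<beta> pq(1,2) unfolding lie_super_hom_def by blast+
  have "u = (if i = 0 then \<beta> p else \<beta> q)"
    using lie_superalgebra.homogeneous_component[OF L parts] u(2) unfolding sum by blast
  then show thesis using that pq by (cases "i = 0") auto
qed

section \<open>Extensions of algebras whose brackets lie on a line\<close>

text \<open>
  The property of the Heisenberg superalgebra behind the two identities is that all brackets are
  multiples of one even vector \<open>z\<close>. The element \<open>t\<close> is the candidate for an element of \<open>Z[L,N]\<close>
  outside the kernel.
\<close>

locale line_bracket_extension =
  L: lie_superalgebra L + N: lie_superalgebra N
  for L :: "('f::field, 'v::ab_group_add) superalgebra"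
    and N :: "('f, 'w::ab_group_add) superalgebra" +
  fixes I :: "'v set" and \<beta> :: "'w \<Rightarrow> 'v" and act :: "'v \<Rightarrow> 'w \<Rightarrow> 'w"
    and \<omega> :: "'v \<Rightarrow> 'v \<Rightarrow> 'f" and z :: 'v and t :: 'w
  assumes ext: "relative_central_extension L I N \<beta> act"
    and bracket_form:
      "\<lbrakk>l \<in> scarrier L; l' \<in> scarrier L\<rbrakk> \<Longrightarrow> bracket L l l' = sscale L (\<omega> l l') z"
    and z_even: "z \<in> part L 0" and z_nonzero: "z \<noteq> 0"
    and t_even: "t \<in> part N 0" and lift_t: "\<beta> t = z"
begin

abbreviation f :: "'v \<Rightarrow> 'w" where "f l \<equiv> act l t"

lemma hom: "lie_super_hom N L \<beta>"
  and action: "lie_super_action L N act"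
  and image: "\<beta> ` scarrier N = I"
  and lift_act: "\<lbrakk>l \<in> scarrier L; x \<in> scarrier N\<rbrakk> \<Longrightarrow> \<beta> (act l x) = bracket L l (\<beta> x)"
  and act_lift: "\<lbrakk>x \<in> scarrier N; y \<in> scarrier N\<rbrakk> \<Longrightarrow> act (\<beta> x) y = bracket N x y"
  and ker_central: "super_ker N \<beta> \<subseteq> act_center L N act"
  using ext unfolding relative_central_extension_def by blast+

lemmas LC = L.part_subset_scarrier and NC = N.part_subset_scarrier

lemma lift_part: "x \<in> part N i \<Longrightarrow> \<beta> x \<in> part L i"
  using hom unfolding lie_super_hom_def by blast

lemma lift_linear:
  assumes x: "x \<in> part N i"
  shows "y \<in> part N i \<Longrightarrow> \<beta> (x + y) = \<beta> x + \<beta> y" "\<beta> (sscale N c x) = sscale L c (\<beta> x)"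
  using hom NC[OF x] NC[of y i] by (simp_all add: lie_super_hom_def linear_on_def)

lemma lift_bracket:
  "\<lbrakk>x \<in> part N i; y \<in> part N j\<rbrakk> \<Longrightarrow> \<beta> (bracket N x y) = bracket L (\<beta> x) (\<beta> y)"
  using hom NC[of x i] NC[of y j] by (simp add: lie_super_hom_def)

lemmas act_bilinear = action[unfolded lie_super_action_def, THEN conjunct1]
  and act_graded = action[unfolded lie_super_action_def, THEN conjunct2]

lemma act_linear_right:
  assumes l: "l \<in> scarrier L" and x: "x \<in> part N i"
  shows "y \<in> part N i \<Longrightarrow> act l (x + y) = act l x + act l y"
    "act l (sscale N c x) = sscale N c (act l x)"
  using act_bilinear l NC[OF x] NC[of y i] by (simp_all add: bilinear_on_def linear_on_def)

lemma act_linear_left: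
  assumes x: "x \<in> scarrier N"
  shows "\<lbrakk>l \<in> scarrier L; l' \<in> scarrier L\<rbrakk> \<Longrightarrow> act (l + l') x = act l x + act l' x"
    "l \<in> scarrier L \<Longrightarrow> act (sscale L c l) x = sscale N c (act l x)"
  using act_bilinear x by (simp_all add: bilinear_on_def linear_on_def)

lemma act_part: "\<lbrakk>l \<in> part L i; x \<in> part N j\<rbrakk> \<Longrightarrow> act l x \<in> part N (i + j)"
  using act_graded[THEN conjunct1] by simp

lemma act_bracket_left:
  "\<lbrakk>l \<in> part L i; l' \<in> part L j; x \<in> part N k\<rbrakk> \<Longrightarrow>
    act (bracket L l l') x = act l (act l' x) - sscale N (ssign i j) (act l' (act l x))"
  using act_graded[THEN conjunct2, THEN conjunct1] by blast

lemma act_bracket_right: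
  "\<lbrakk>l \<in> part L i; x \<in> part N j; y \<in> part N k\<rbrakk> \<Longrightarrow>
    act l (bracket N x y) = bracket N (act l x) y + sscale N (ssign i j) (bracket N x (act l y))"
  using act_graded[THEN conjunct2, THEN conjunct2] by blast

lemma form_parity:
  assumes "l \<in> part L i" "l' \<in> part L j" "i \<noteq> j"
  shows "\<omega> l l' = 0"
proof -
  have ij: "i + j = 1" using assms(3) by (cases i; cases j) auto
  have "sscale L (\<omega> l l') z \<in> part L 1"
    using L.bracket_even[OF assms(1,2)] bracket_form[OF LC[OF assms(1)] LC[OF assms(2)]]
    by (simp only: ij)
  moreover have "sscale L (\<omega> l l') z \<in> part L 0"
    by (rule L.subspace_scale[OF L.subspace_part z_even])
  ultimately have "sscale L (\<omega> l l') z = 0" using L.parts_independent by blast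
  then show ?thesis using z_nonzero by simp
qed

text \<open>
  If \<open>\<beta> x\<close> is a nonzero multiple of \<open>z\<close>, then \<open>x\<close> has the parity of \<open>t\<close>; otherwise \<open>x\<close> itself lies
  in the kernel. In both cases \<open>x\<close> and the corresponding multiple of \<open>t\<close> differ by an element of
  the kernel, on which \<open>L\<close> acts trivially.
\<close>

lemma act_over_line:
  assumes l: "l \<in> scarrier L" and x: "x \<in> part N i" and \<beta>x: "\<beta> x = sscale L c z"
  shows "act l x = sscale N c (f l)"
proof -
  have ker: "act l y = 0" if "y \<in> scarrier N" "\<beta> y = 0" for y
    using ker_central that l unfolding super_ker_def act_center_def by blast
  show ?thesis
  proof (cases "i = 0")
    case True
    let ?s = "sscale N (- c) t"
    have s: "?s \<in> part N i"
      unfolding True by (rule N.subspace_scale[OF N.subspace_part t_even])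
    have xs: "x + ?s \<in> scarrier N"
      by (rule NC[OF N.subspace_add[OF N.subspace_part x s]])
    have "\<beta> (x + ?s) = 0"
      using lift_linear(1)[OF x s] lift_linear(2)[OF t_even, of "- c"] \<beta>x lift_t by simp
    then have "act l (x + ?s) = 0" using ker xs by blast
    then show ?thesis
      using act_linear_right(1)[OF l x s] act_linear_right(2)[OF l t_even, of "- c"] by simp
  next
    case False
    then have i: "i = 1" by simp
    have "\<beta> x \<in> part L 1" using lift_part[OF x] unfolding i .
    moreover have "\<beta> x \<in> part L 0"
      unfolding \<beta>x by (rule L.subspace_scale[OF L.subspace_part z_even])
    ultimately have 0: "\<beta> x = 0" using L.parts_independent by blast
    then have "c = 0" using \<beta>x z_nonzero by simp
    then show ?thesis using ker[OF NC[OF x] 0] by simp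
  qed
qed

lemma act_act:
  assumes l: "l \<in> part L i" and l': "l' \<in> part L j" and x: "x \<in> part N k"
  shows "act l (act l' x) = sscale N (\<omega> l' (\<beta> x)) (f l)"
proof -
  have \<beta>x: "\<beta> x \<in> part L k" by (rule lift_part[OF x])
  have "\<beta> (act l' x) = sscale L (\<omega> l' (\<beta> x)) z"
    using lift_act[OF LC[OF l'] NC[OF x]] bracket_form[OF LC[OF l'] LC[OF \<beta>x]] by simp
  then show ?thesis using act_over_line[OF LC[OF l] act_part[OF l' x]] by simp
qed

text \<open>
  Exchanging the roles of \<open>z\<close> and \<open>t\<close>: both sides are, up to sign, the bracket of \<open>t\<close> and \<open>x\<close> in
  \<open>N\<close>. No sign depends on the parity of \<open>x\<close>, because \<open>t\<close> is even.
\<close>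

lemma act_z:
  assumes x: "x \<in> part N k"
  shows "act z x = - f (\<beta> x)"
proof -
  have "act z x = bracket N t x" using act_lift[OF NC[OF t_even] NC[OF x]] lift_t by simp
  also have "\<dots> = - bracket N x t"
    using N.bracket_skew[OF t_even x] by (simp add: ssign_def)
  also have "bracket N x t = f (\<beta> x)" using act_lift[OF NC[OF x] NC[OF t_even]] by simp
  finally show ?thesis .
qed

lemma act_multiple_of_z:
  assumes "x \<in> part N k" shows "act (sscale L c z) x = - sscale N c (f (\<beta> x))"
  using act_linear_left(2)[OF NC[OF assms] LC[OF z_even]] act_z[OF assms] by simp

lemma ideal_lift:
  assumes "u \<in> I" "u \<in> part L i"
  obtains x where "x \<in> part N i" "\<beta> x = u"
  using homogeneous_lift[OF L.lie_superalgebra_axioms hom _ assms(2) N.lie_superalgebra_axioms]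
    assms(1) image by blast

text \<open>
  This is the derivation rule for \<open>l\<close> acting on \<open>[x,y]\<close>, where \<open>x\<close>, \<open>y\<close> lift \<open>u\<close>, \<open>v\<close>. The results
  of \<open>l\<close> acting on \<open>x\<close> and on \<open>y\<close>, like \<open>[x,y]\<close> itself, lie over multiples of \<open>z\<close>, so that each
  term becomes a multiple of a value of \<open>f\<close>.
\<close>

lemma form_times_value:
  assumes l: "l \<in> part L k" and u: "u \<in> I" "u \<in> part L i" and v: "v \<in> I" "v \<in> part L j"
  shows "sscale N (\<omega> u v) (f l) =
    - sscale N (\<omega> l u) (f v) + sscale N (ssign k i * \<omega> l v) (f u)"
proof -
  obtain x where x: "x \<in> part N i" "\<beta> x = u" using ideal_lift[OF u] .
  obtain y where y: "y \<in> part N j" "\<beta> y = v" using ideal_lift[OF v] .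
  have "\<beta> (bracket N x y) = sscale L (\<omega> u v) z"
    using lift_bracket[OF x(1) y(1)] x(2) y(2) bracket_form[OF LC[OF u(2)] LC[OF v(2)]] by simp
  then have "sscale N (\<omega> u v) (f l) = act l (bracket N x y)"
    by (rule act_over_line[OF LC[OF l] N.bracket_even[OF x(1) y(1)], symmetric])
  also have "\<dots> = bracket N (act l x) y + sscale N (ssign k i) (bracket N x (act l y))"
    using act_bracket_right[OF l x(1) y(1)] .
  also have "bracket N (act l x) y = act (\<beta> (act l x)) y"
    using act_lift[OF NC[OF act_part[OF l x(1)]] NC[OF y(1)]] by simp
  also have "\<beta> (act l x) = sscale L (\<omega> l u) z"
    using lift_act[OF LC[OF l] NC[OF x(1)]] bracket_form[OF LC[OF l] LC[OF u(2)]] x by simp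
  also have "act (sscale L (\<omega> l u) z) y = - sscale N (\<omega> l u) (f v)"
    using act_multiple_of_z[OF y(1)] y by simp
  also have "bracket N x (act l y) = act u (act l y)"
    using act_lift[OF NC[OF x(1)] NC[OF act_part[OF l y(1)]]] x by simp
  also have "\<dots> = sscale N (\<omega> l v) (f u)" using act_act[OF u(2) l y(1)] y by simp
  finally show ?thesis by simp
qed

text \<open>
  This is the action of \<open>[l,l']\<close>, a multiple of \<open>z\<close>, on a lift of \<open>u\<close>, written as the supercommutator
  of the actions of \<open>l\<close> and \<open>l'\<close>.
\<close>

lemma value_of_ideal_element:
  assumes l: "l \<in> part L i" "l' \<in> part L j" and u: "u \<in> I" "u \<in> part L k"
  shows "- sscale N (\<omega> l l') (f u) =
    sscale N (\<omega> l' u) (f l) - sscale N (ssign i j * \<omega> l u) (f l')"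
proof -
  obtain x where x: "x \<in> part N k" "\<beta> x = u" using ideal_lift[OF u] .
  have "- sscale N (\<omega> l l') (f u) = act (bracket L l l') x"
    using act_multiple_of_z[OF x(1)] x bracket_form[OF LC[OF l(1)] LC[OF l(2)]] by simp
  also have "\<dots> = act l (act l' x) - sscale N (ssign i j) (act l' (act l x))"
    using act_bracket_left[OF l x(1)] .
  finally show ?thesis using act_act[OF l x(1)] act_act[OF l(2) l(1) x(1)] x by simp
qed

text \<open>
  For even \<open>b\<close> and \<open>c\<close>, orthogonality to \<open>a\<close> makes \<open>f b\<close> and \<open>f c\<close> multiples of \<open>f a\<close> whose
  contributions cancel. For odd \<open>b\<close> and \<open>c\<close> both contributions vanish, since odd elements are
  orthogonal to \<open>u\<close>.
\<close>

lemma even_value_zero: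
  assumes u: "u \<in> I" "u \<in> part L 0" and a: "a \<in> part L 0" "\<omega> a u \<noteq> 0"
    and bc: "b \<in> part L k" "c \<in> part L k"
    and orth: "\<omega> a b = 0" "\<omega> a c = 0" and bc1: "\<omega> b c \<noteq> 0"
  shows "f u = 0"
proof -
  have e: "sscale N (\<omega> a u) (f d) = sscale N (\<omega> d u) (f a)"
    if "d \<in> part L k" "\<omega> a d = 0" for d
    using value_of_ideal_element[OF a(1) that(1) u] that(2) by (simp add: ssign_def)
  have "sscale N (\<omega> c u) (f b) - sscale N (ssign k k * \<omega> b u) (f c) = 0"
  proof (cases "k = 0")
    case True
    have "sscale N (\<omega> a u) (sscale N (\<omega> c u) (f b) - sscale N (\<omega> b u) (f c))
        = sscale N (\<omega> c u) (sscale N (\<omega> a u) (f b)) - sscale N (\<omega> b u) (sscale N (\<omega> a u) (f c))"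
      by (simp add: N.scale_right_diff_distrib mult.commute)
    also have "\<dots> = 0" using e[OF bc(1) orth(1)] e[OF bc(2) orth(2)] by (simp add: mult.commute)
    finally show ?thesis using a(2) True by (simp add: ssign_def)
  next
    case False
    then show ?thesis using form_parity[OF bc(1) u(2)] form_parity[OF bc(2) u(2)] by simp
  qed
  then show ?thesis using value_of_ideal_element[OF bc u] bc1 by simp
qed

text \<open>
  The identity of lemma \<open>form_times_value\<close> for \<open>l = u\<close>. When \<open>v = u\<close> as well, it expresses that an
  odd element commutes with its own square, whose Jacobi identity carries the factor 3.
\<close>

lemma odd_value_relation:
  assumes "u \<in> I" "u \<in> part L 1" "v \<in> I" "v \<in> part L 1"
  shows "sscale N (2 * \<omega> u v) (f u) = - sscale N (\<omega> u u) (f v)"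
proof -
  have double: "p + p = - q" if "p = - q - p" for p q :: 'w
    using that by (metis diff_add_cancel)
  have "sscale N (\<omega> u v) (f u) = - sscale N (\<omega> u u) (f v) - sscale N (\<omega> u v) (f u)"
    using form_times_value[OF assms(2,1,2,3,4)] by (simp only: ssign_def) simp
  from double[OF this] show ?thesis by (simp only: mult_2 N.scale_left_distrib)
qed

text \<open>
  A non-isotropic vector \<open>u\<close> can be paired with itself, so the pair obtained may differ from the
  given one.
\<close>

lemma odd_values_zero:
  assumes char: "(2::'f) \<noteq> 0" "(3::'f) \<noteq> 0"
    and u: "u \<in> I" "u \<in> part L 1" and v: "v \<in> I" "v \<in> part L 1"
    and uv: "\<omega> u v \<noteq> 0" "\<omega> v u \<noteq> 0"
  obtains u' v' where "u' \<in> I" "u' \<in> part L 1" "v' \<in> I" "v' \<in> part L 1"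
    "\<omega> u' v' \<noteq> 0" "f u' = 0" "f v' = 0"
proof -
  have nonisotropic: "f w = 0" if w: "w \<in> I" "w \<in> part L 1" "\<omega> w w \<noteq> 0" for w
  proof -
    have "sscale N (3 * \<omega> w w) (f w) = sscale N (2 * \<omega> w w) (f w) + sscale N (\<omega> w w) (f w)"
      by (simp only: N.scale_left_distrib[symmetric]) simp
    also have "\<dots> = 0" using odd_value_relation[OF w(1,2) w(1,2)] by simp
    finally show ?thesis using char w(3) by simp
  qed
  consider "\<omega> u u \<noteq> 0" | "\<omega> v v \<noteq> 0" | "\<omega> u u = 0" "\<omega> v v = 0" by blast
  then show thesis
  proof cases
    case 1 then show thesis using that[OF u u] nonisotropic[OF u] by blast
  next
    case 2 then show thesis using that[OF v v] nonisotropic[OF v] by blast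
  next
    case 3
    have "f u = 0" "f v = 0"
      using odd_value_relation[OF u v] odd_value_relation[OF v u] 3 uv char by simp_all
    then show thesis using that[OF u v uv(1)] by blast
  qed
qed

lemma t_in_act_center:
  assumes u: "u \<in> I" "u \<in> part L i" and v: "v \<in> I" "v \<in> part L j"
    and uv: "\<omega> u v \<noteq> 0" "f u = 0" "f v = 0"
  shows "t \<in> act_center L N act"
proof -
  have hom0: "f l = 0" if "l \<in> part L k" for l k
    using form_times_value[OF that u v] uv by simp
  have "f l = 0" if "l \<in> scarrier L" for l
  proof -
    obtain a b where ab: "l = a + b" "a \<in> part L 0" "b \<in> part L 1"
      using \<open>l \<in> scarrier L\<close> unfolding scarrier_def by blast
    then show ?thesis
      using act_linear_left(1)[OF NC[OF t_even] LC[OF ab(2)] LC[OF ab(3)]]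
        hom0[OF ab(2)] hom0[OF ab(3)] by simp
  qed
  then show ?thesis using NC[OF t_even] unfolding act_center_def by blast
qed

end

section \<open>The form of the Heisenberg superalgebra\<close>

definition heis_form :: "nat \<Rightarrow> nat \<Rightarrow> (heis_basis \<Rightarrow> 'f::field) \<Rightarrow> (heis_basis \<Rightarrow> 'f) \<Rightarrow> 'f" where
  "heis_form m n u v = bracket (heisenberg m n) u v Z"

lemma heisenberg_bracket_form:
  "bracket (heisenberg m n) u v = sscale (heisenberg m n) (heis_form m n u v) (heis_unit Z)"
  by (auto simp: heisenberg_simps heis_form_def heis_unit_def fun_eq_iff)

lemma heis_form_unit:
  fixes v :: "heis_basis \<Rightarrow> 'f::field"
  shows "i \<in> {1..m} \<Longrightarrow> heis_form m n (heis_unit (X i)) v = v (X (m + i))"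
    and "i \<in> {1..m} \<Longrightarrow> heis_form m n (heis_unit (X (m + i))) v = - v (X i)"
    and "j \<in> {1..n} \<Longrightarrow> heis_form m n (heis_unit (Y j)) v = v (Y j)"
proof -
  have if_mult: "(if P then 1 else 0) * x = (if P then x else 0)" for P and x :: 'f by simp
  have expand: "heis_form m n (heis_unit b) v =
    (\<Sum>k=1..m. (if X k = b then v (X (m + k)) else 0) - (if X (m + k) = b then v (X k) else 0)) +
    (\<Sum>k=1..n. if Y k = b then v (Y k) else 0)" for b
    by (simp only: heis_form_def heisenberg_simps heis_unit_def if_mult simp_thms if_True)
  show "heis_form m n (heis_unit (X i)) v = v (X (m + i))" if i: "i \<in> {1..m}"
  proof -
    have "m + k \<noteq> i" if "k \<in> {1..m}" for k using that i by auto
    then have "heis_form m n (heis_unit (X i)) v = (\<Sum>k=1..m. if k = i then v (X (m + k)) else 0)"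
      unfolding expand by (auto intro!: sum.cong simp del: sum.delta sum.delta')
    then show ?thesis using i by simp
  qed
  show "heis_form m n (heis_unit (X (m + i))) v = - v (X i)" if i: "i \<in> {1..m}"
  proof -
    have "k \<noteq> m + i" if "k \<in> {1..m}" for k using that i by auto
    then have "heis_form m n (heis_unit (X (m + i))) v = (\<Sum>k=1..m. if k = i then - v (X k) else 0)"
      unfolding expand by (auto intro!: sum.cong simp del: sum.delta sum.delta')
    then show ?thesis using i by simp
  qed
  show "heis_form m n (heis_unit (Y j)) v = v (Y j)" if j: "j \<in> {1..n}"
    unfolding expand using j by simp
qed

lemma heis_unit_part:
  "i \<in> {1..2 * m} \<Longrightarrow> heis_unit (X i) \<in> part (heisenberg m n) 0"
  "j \<in> {1..n} \<Longrightarrow> heis_unit (Y j) \<in> part (heisenberg m n) 1"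
  "heis_unit Z \<in> part (heisenberg m n) 0"
  by (auto simp: heisenberg_simps heis_unit_def heis_index_def)

lemma heis_form_skew:
  assumes "u \<in> part (heisenberg m n) i" "v \<in> part (heisenberg m n) j"
  shows "heis_form m n u v = - (ssign i j * heis_form m n v u)"
  using lie_superalgebra.bracket_skew[OF lie_superalgebra_heisenberg assms]
  by (simp add: heis_form_def heisenberg_simps(1) fun_eq_iff)

text \<open>
  The vector \<open>a\<close> is dual to a nonzero coordinate of \<open>u\<close>. The hypothesis \<open>m + n \<ge> 2\<close> leaves room
  for \<open>b\<close> and \<open>c\<close>: an odd basis vector taken twice, or another hyperbolic pair.
\<close>

lemma even_not_central_witnesses:
  fixes u v :: "heis_basis \<Rightarrow> 'f::field"
  assumes mn: "m + n \<ge> 2"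
    and v: "v \<in> part (heisenberg m n) 0" and uv: "heis_form m n u v \<noteq> 0"
  obtains a b c :: "heis_basis \<Rightarrow> 'f" and k where
    "a \<in> part (heisenberg m n) 0" "heis_form m n a u \<noteq> 0"
    "b \<in> part (heisenberg m n) k" "c \<in> part (heisenberg m n) k"
    "heis_form m n a b = 0" "heis_form m n a c = 0" "heis_form m n b c \<noteq> 0"
proof -
  have vY: "v (Y j) = 0" for j using v by (auto simp: heisenberg_simps Y_notin_index_0)
  have "\<exists>i\<in>{1..m}. u (X i) \<noteq> 0 \<or> u (X (m + i)) \<noteq> 0"
  proof (rule ccontr)
    assume "\<not> ?thesis"
    then have "heis_form m n u v = 0" using vY by (simp add: heis_form_def heisenberg_simps)
    then show False using uv by simp
  qed
  then obtain i where i: "i \<in> {1..m}" "u (X i) \<noteq> 0 \<or> u (X (m + i)) \<noteq> 0" by blast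
  define a :: "heis_basis \<Rightarrow> 'f"
    where "a = heis_unit (X (if u (X i) \<noteq> 0 then m + i else i))"
  have a: "a \<in> part (heisenberg m n) 0"
    unfolding a_def using i by (intro heis_unit_part(1)) auto
  have au: "heis_form m n a u \<noteq> 0"
    using i heis_form_unit(1,2)[OF i(1), of n u] by (auto simp: a_def)
  have orth: "heis_form m n a w = 0" if "w (X i) = 0" "w (X (m + i)) = 0" for w
    using that heis_form_unit(1,2)[OF i(1), of n w] by (auto simp: a_def)
  show thesis
  proof (cases "n = 0")
    case False
    then have 1: "1 \<in> {1..n}" by simp
    let ?b = "heis_unit (Y 1) :: heis_basis \<Rightarrow> 'f"
    have "heis_form m n a ?b = 0" by (rule orth) (simp_all add: heis_unit_def)
    moreover have "heis_form m n ?b ?b \<noteq> 0"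
      using heis_form_unit(3)[OF 1, of m ?b] by (simp add: heis_unit_def)
    ultimately show thesis using that[OF a au heis_unit_part(2)[OF 1] heis_unit_part(2)[OF 1]] by blast
  next
    case True
    \<comment> \<open>any index other than \<open>i\<close>; it is at most \<open>m\<close> because \<open>m \<ge> 2\<close> when \<open>n = 0\<close>\<close>
    define k where "k = (if i = 1 then 2 else 1 :: nat)"
    have k: "k \<in> {1..m}" "k \<noteq> i" using True mn by (auto simp: k_def)
    let ?b = "heis_unit (X k) :: heis_basis \<Rightarrow> 'f" and ?c = "heis_unit (X (m + k)) :: heis_basis \<Rightarrow> 'f"
    have "heis_form m n a ?b = 0" "heis_form m n a ?c = 0"
      using k i by (auto intro!: orth simp: heis_unit_def)
    moreover have "heis_form m n ?b ?c \<noteq> 0"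
      using heis_form_unit(1)[OF k(1), of n ?c] by (simp add: heis_unit_def)
    moreover have "?b \<in> part (heisenberg m n) 0" "?c \<in> part (heisenberg m n) 0"
      using k by (auto intro!: heis_unit_part(1))
    ultimately show thesis using that[OF a au] by blast
  qed
qed

text \<open>
  Even and odd vectors are orthogonal, so a nonzero bracket of two elements of a graded ideal comes
  from their even components or from their odd components.
\<close>

lemma nonabelian_homogeneous_pair:
  fixes I :: "(heis_basis \<Rightarrow> 'f::field) set"
  assumes ideal: "graded_ideal (heisenberg m n) I" and nonab: "\<not> abelian_on (heisenberg m n) I"
  obtains u v i where "u \<in> I" "u \<in> part (heisenberg m n) i" "v \<in> I" "v \<in> part (heisenberg m n) i"
    "heis_form m n u v \<noteq> 0"
proof -
  let ?H = "heisenberg m n :: ('f, heis_basis \<Rightarrow> 'f) superalgebra"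
  obtain x y where xy: "x \<in> I" "y \<in> I" "bracket ?H x y \<noteq> 0"
    using nonab unfolding abelian_on_def by blast
  then have nz: "heis_form m n x y \<noteq> 0"
    by (auto simp: heisenberg_bracket_form[of m n x y] heisenberg_simps(1) fun_eq_iff)
  obtain a b where x: "a \<in> I" "a \<in> part ?H 0" "b \<in> I" "b \<in> part ?H 1" "x = a + b"
    using ideal xy(1) unfolding graded_ideal_def by blast
  obtain c d where y: "c \<in> I" "c \<in> part ?H 0" "d \<in> I" "d \<in> part ?H 1" "y = c + d"
    using ideal xy(2) unfolding graded_ideal_def by blast
  have even: "v (Y j) = 0" if "v \<in> part ?H 0" for v j
    using that Y_notin_index_0 by (auto simp: heisenberg_simps)
  have odd: "v (X j) = 0" if "v \<in> part ?H 1" for v j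
    using that X_notin_index_1 by (auto simp: heisenberg_simps)
  have "heis_form m n x y = heis_form m n a c + heis_form m n b d"
    using even[OF x(2)] even[OF y(2)] odd[OF x(4)] odd[OF y(4)] x(5) y(5)
    by (simp add: heis_form_def heisenberg_simps)
  then have "heis_form m n a c \<noteq> 0 \<or> heis_form m n b d \<noteq> 0" using nz by auto
  then show thesis using that x y by blast
qed

section \<open>Pairs with a non-abelian ideal\<close>

lemma of_nat_2_3_nonzero:
  assumes p: "p = 2 \<or> p = 3" and char: "CHAR('f::field) \<noteq> p"
  shows "of_nat p \<noteq> (0::'f)"
proof
  have small: "c = 1 \<or> c = p" if "c dvd p" for c :: nat
  proof -
    have "c \<le> p" using dvd_imp_le[OF that] p by linarith
    then have "c = 0 \<or> c = 1 \<or> c = 2 \<or> c = 3" using p by linarith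
    then show ?thesis using that p by (elim disjE) simp_all
  qed
  assume "of_nat p = (0::'f)"
  then have "CHAR('f) dvd p" by (simp only: of_nat_eq_0_iff_char_dvd)
  then have "CHAR('f) = 1" using small char by blast
  then show False using of_nat_CHAR[where 'a = 'f] by (metis of_nat_1 zero_neq_one)
qed

theorem theorem6p7:
  fixes m n :: nat and I :: "(heis_basis \<Rightarrow> 'f::field) set"
  assumes "CHAR('f) \<noteq> 2" and "CHAR('f) \<noteq> 3"
    and "m + n \<ge> 2"
    and "graded_ideal (heisenberg m n) I"
    and "\<not> abelian_on (heisenberg m n) I"
  shows "\<not> capable_pair TYPE('w::ab_group_add) (heisenberg m n) I"
proof
  let ?H = "heisenberg m n :: ('f, heis_basis \<Rightarrow> 'f) superalgebra"
  let ?\<omega> = "heis_form m n :: (heis_basis \<Rightarrow> 'f) \<Rightarrow> (heis_basis \<Rightarrow> 'f) \<Rightarrow> 'f"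
  let ?z = "heis_unit Z :: heis_basis \<Rightarrow> 'f"
  have "of_nat 2 \<noteq> (0::'f)" "of_nat 3 \<noteq> (0::'f)"
    using of_nat_2_3_nonzero assms(1,2) by blast+
  then have char: "(2::'f) \<noteq> 0" "(3::'f) \<noteq> 0" by simp_all
  assume "capable_pair TYPE('w) ?H I"
  then obtain N :: "('f, 'w) superalgebra" and \<beta> act where
    ext: "relative_central_extension ?H I N \<beta> act" and cap: "super_ker N \<beta> = act_center ?H N act"
    unfolding capable_pair_def by blast
  have N: "lie_superalgebra N" and hom: "lie_super_hom N ?H \<beta>" and image: "\<beta> ` scarrier N = I"
    using ext unfolding relative_central_extension_def by blast+
  interpret H: lie_superalgebra ?H by (rule lie_superalgebra_heisenberg)
  interpret N: lie_superalgebra N by (rule N)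
  obtain u v i where u: "u \<in> I" "u \<in> part ?H i" and v: "v \<in> I" "v \<in> part ?H i"
    and uv: "?\<omega> u v \<noteq> 0"
    using nonabelian_homogeneous_pair[OF assms(4,5)] .
  have vu: "?\<omega> v u \<noteq> 0" using heis_form_skew[OF u(2) v(2)] uv by auto
  obtain x where x: "x \<in> part N i" "\<beta> x = u"
    using homogeneous_lift[OF H.lie_superalgebra_axioms hom _ u(2) N] u(1) image by blast
  obtain y where y: "y \<in> part N i" "\<beta> y = v"
    using homogeneous_lift[OF H.lie_superalgebra_axioms hom _ v(2) N] v(1) image by blast
  define t where "t = sscale N (inverse (?\<omega> u v)) (bracket N x y)"
  have ii: "i + i = 0" by (cases i) simp_all
  have xy: "bracket N x y \<in> part N 0" using N.bracket_even[OF x(1) y(1)] by (simp only: ii)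
  have xyN: "x \<in> scarrier N" "y \<in> scarrier N" "bracket N x y \<in> scarrier N"
    using x(1) y(1) xy by (blast intro: N.part_subset_scarrier)+
  have t: "t \<in> part N 0"
    unfolding t_def by (rule N.subspace_scale[OF N.subspace_part xy])
  have "\<beta> t = sscale ?H (inverse (?\<omega> u v)) (\<beta> (bracket N x y))"
    using hom xyN(3) by (simp add: t_def lie_super_hom_def linear_on_def)
  also have "\<beta> (bracket N x y) = bracket ?H u v"
    using hom xyN(1,2) x(2) y(2) by (simp add: lie_super_hom_def)
  finally have \<beta>t: "\<beta> t = ?z"
    using uv by (simp add: heisenberg_bracket_form[of m n u v])
  have z: "?z \<noteq> 0" by (auto simp: heis_unit_def fun_eq_iff)
  interpret E: line_bracket_extension ?H N I \<beta> act ?\<omega> ?z t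
    by unfold_locales (rule ext heisenberg_bracket_form heis_unit_part(3) z t \<beta>t)+
  have "t \<in> act_center ?H N act"
  proof (cases "i = 0")
    case True
    have zero: "E.f w = 0" if w: "w \<in> I" "w \<in> part ?H 0" "w' \<in> part ?H 0" "?\<omega> w w' \<noteq> 0" for w w'
    proof -
      obtain a b c :: "heis_basis \<Rightarrow> 'f" and k where
        "a \<in> part ?H 0" "?\<omega> a w \<noteq> 0" "b \<in> part ?H k" "c \<in> part ?H k"
        "?\<omega> a b = 0" "?\<omega> a c = 0" "?\<omega> b c \<noteq> 0"
        using even_not_central_witnesses[OF assms(3) w(3,4)] .
      then show ?thesis by (rule E.even_value_zero[OF w(1,2)])
    qed
    show ?thesis
      using E.t_in_act_center[OF u v uv] zero[OF u(1) _ _ uv] zero[OF v(1) _ _ vu] u(2) v(2)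
      unfolding True by blast
  next
    case False
    then have i: "i = 1" by simp
    obtain u' v' where odd: "u' \<in> I" "u' \<in> part ?H 1" "v' \<in> I" "v' \<in> part ?H 1"
        "?\<omega> u' v' \<noteq> 0" "E.f u' = 0" "E.f v' = 0"
      using E.odd_values_zero[OF char u(1) u(2)[unfolded i] v(1) v(2)[unfolded i] uv vu] .
    then show ?thesis by (rule E.t_in_act_center)
  qed
  then have "\<beta> t = 0" using cap unfolding super_ker_def by blast
  then show False using \<beta>t z by simp
qed

end
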